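(* Let $X$ be a real-valued random variable on a probability space $(\Omega,\mathcal{F},\mathbb{P})$ with finite expected value $\mathbb{E}(X)$ and nonzero variance $\sigma^2$. Then for any $n\ge 1$ and any real numbers $0=\lambda_0<\lambda_1<\lambda_2<\cdots<\lambda_n<\infty$, $$\sum_{k=1}^{n}(\lambda_k^2-\lambda_{k-1}^2)\,\mathbb{P}(|X-\mathbb{E}(X)|\ge\lambda_k)\le\sigma^2.$$
   Context: $\sigma^2=\mathbb{E}\big((X-\mathbb{E}(X))^2\big)$ is the variance of $X$; the inequality is trivial if it is $+\infty$. *)

theory Defs
  imports "HOL-Probability.Probability"
begin

(* The library's variance is a Bochner integral and hence 0 when X is integrable but
   not square-integrable. Here the variance takes values in [0, \<infinity>]. *)
definition ext_variance :: "'a measure \<Rightarrow> ('a \<Rightarrow> real) \<Rightarrow> ennreal" where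
  "ext_variance M X = (\<integral>\<^sup>+ \<omega>. ennreal ((X \<omega> - (\<integral>\<omega>'. X \<omega>' \<partial>M))\<^sup>2) \<partial>M)"

lemma (in prob_space) ext_variance_eq_variance:
  assumes "integrable M X" and "integrable M (\<lambda>\<omega>. (X \<omega>)\<^sup>2)"
  shows "ext_variance M X = ennreal (variance X)"
proof -
  have "integrable M (\<lambda>\<omega>. (X \<omega> - expectation X)\<^sup>2)"
    using assms by (simp add: power2_diff)
  then show ?thesis
    unfolding ext_variance_def by (intro nn_integral_eq_integral) auto
qed

end

theory Submission imports Defs begin

text \<open>
  The inequality is Markov's inequality applied on several levels at once. For levels
  \<open>0 = c 0 \<le> \<dots> \<le> c n\<close> the sum of \<open>(c k - c (k - 1)) * of_bool (c k \<le> t)\<close> is the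
  staircase that rounds \<open>t \<ge> 0\<close> down to the nearest level, so it is at most \<open>t\<close>
  (lemma \<open>staircase_le\<close>). Substituting a nonnegative random variable for \<open>t\<close> and
  integrating turns the indicators into tail probabilities (lemma \<open>layered_Markov\<close>).
  The theorem is the case \<open>f = (X - E X)\<^sup>2\<close> with levels \<open>c k = (lam k)\<^sup>2\<close>, since the events
  \<open>\<bar>X - E X\<bar> \<ge> lam k\<close> and \<open>(X - E X)\<^sup>2 \<ge> (lam k)\<^sup>2\<close> coincide for \<open>lam k \<ge> 0\<close>.
\<close>

lemma mono_of_steps:
  fixes c :: "nat \<Rightarrow> real"
  assumes "\<And>k. k < n \<Longrightarrow> c k \<le> c (Suc k)" and "j \<le> k" and "k \<le> n"
  shows "c j \<le> c k"
  using assms(2,3)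
proof (induction rule: dec_induct)
  case (step m)
  then show ?case using assms(1)[of m] by simp
qed simp

text \<open>
  Induction on the number of levels: if \<open>t\<close> reaches the topmost level, it reaches all of them
  and the sum telescopes to that level; otherwise the topmost term vanishes.
\<close>

lemma staircase_le:
  fixes c :: "nat \<Rightarrow> real"
  assumes "c 0 = 0" and "\<And>k. k < n \<Longrightarrow> c k \<le> c (Suc k)" and "0 \<le> t"
  shows "(\<Sum>k=1..n. (c k - c (k - 1)) * of_bool (c k \<le> t)) \<le> t"
  using assms(2)
proof (induction n)
  case 0
  show ?case using \<open>0 \<le> t\<close> by simp
next
  case (Suc n)
  show ?case
  proof (cases "c (Suc n) \<le> t")
    case True
    have below: "c k \<le> t" if "k \<le> Suc n" for k
      using mono_of_steps[of "Suc n" c k "Suc n"] Suc.prems that True by simp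
    have "(\<Sum>k=1..Suc n. (c k - c (k - 1)) * of_bool (c k \<le> t))
        = (\<Sum>k=1..Suc n. c k - c (k - 1))"
      by (intro sum.cong refl) (simp add: below)
    also have "\<dots> = c (Suc n)"
      using sum_telescope''[of 0 "Suc n" c] assms(1) by simp
    finally show ?thesis using True by simp
  next
    case False
    then show ?thesis using Suc.IH Suc.prems by simp
  qed
qed

text \<open>
  The left-hand side is the integral of the staircase below \<open>f\<close>. The staircase is bounded, hence
  integrable even where \<open>f\<close> has infinite integral; the comparison of the two therefore takes
  place in \<open>[0, \<infinity>]\<close>.
\<close>

lemma (in finite_measure) layered_Markov:
  fixes f :: "'a \<Rightarrow> real" and c :: "nat \<Rightarrow> real"
  assumes f [measurable]: "f \<in> borel_measurable M"
    and nonneg: "\<And>x. x \<in> space M \<Longrightarrow> 0 \<le> f x"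
    and c0: "c 0 = 0" and c_step: "\<And>k. k < n \<Longrightarrow> c k \<le> c (Suc k)"
  shows "ennreal (\<Sum>k=1..n. (c k - c (k - 1)) * measure M {x \<in> space M. c k \<le> f x})
         \<le> (\<integral>\<^sup>+ x. ennreal (f x) \<partial>M)"
proof -
  define A where "A = (\<lambda>k. {x \<in> space M. c k \<le> f x})"
  define s where "s = (\<lambda>x. \<Sum>k=1..n. (c k - c (k - 1)) * indicator (A k) x)"
  have A [measurable]: "A k \<in> sets M" for k
    unfolding A_def by measurable
  have int: "integrable M (\<lambda>x. (c k - c (k - 1)) * indicator (A k) x)" for k
    by (simp add: integrable_real_indicator emeasure_eq_measure)
  have s_int: "integrable M s"
    unfolding s_def by (intro Bochner_Integration.integrable_sum int)
  have "0 \<le> c k - c (k - 1)" if "k \<in> {1..n}" for k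
    using c_step[of "k - 1"] that by auto
  then have s_nonneg: "0 \<le> s x" for x
    unfolding s_def by (intro sum_nonneg mult_nonneg_nonneg) auto
  have s_le: "s x \<le> f x" if "x \<in> space M" for x
  proof -
    have "s x = (\<Sum>k=1..n. (c k - c (k - 1)) * of_bool (c k \<le> f x))"
      unfolding s_def A_def using that by (intro sum.cong) (auto simp: indicator_def)
    also have "\<dots> \<le> f x"
      using c0 c_step nonneg[OF that] by (rule staircase_le)
    finally show ?thesis .
  qed
  have "(\<integral>x. s x \<partial>M) = (\<Sum>k=1..n. (c k - c (k - 1)) * measure M (A k))"
    unfolding s_def using int by (subst Bochner_Integration.integral_sum) auto
  then have "ennreal (\<Sum>k=1..n. (c k - c (k - 1)) * measure M (A k)) = (\<integral>\<^sup>+ x. ennreal (s x) \<partial>M)"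
    using nn_integral_eq_integral[OF s_int] s_nonneg by simp
  also have "\<dots> \<le> (\<integral>\<^sup>+ x. ennreal (f x) \<partial>M)"
    by (intro nn_integral_mono ennreal_leI s_le)
  finally show ?thesis unfolding A_def .
qed

theorem corollary3p4:
  fixes M :: "'a measure" and X :: "'a \<Rightarrow> real" and lam :: "nat \<Rightarrow> real" and n :: nat
  assumes "prob_space M"
    and "X \<in> borel_measurable M"
    and "integrable M X"
    and "ext_variance M X \<noteq> 0"
    and "n \<ge> 1"
    and "lam 0 = 0"
    and "\<And>k. k < n \<Longrightarrow> lam k < lam (Suc k)"
  shows "ennreal (\<Sum>k=1..n. ((lam k)\<^sup>2 - (lam (k - 1))\<^sup>2) *
           measure M {\<omega> \<in> space M. \<bar>X \<omega> - (\<integral>\<omega>'. X \<omega>' \<partial>M)\<bar> \<ge> lam k})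
         \<le> ext_variance M X"
proof -
  interpret prob_space M by fact
  note [measurable] = \<open>X \<in> borel_measurable M\<close>
  define Y where "Y = (\<lambda>\<omega>. X \<omega> - (\<integral>\<omega>'. X \<omega>' \<partial>M))"
  have lam_nonneg: "0 \<le> lam k" if "k \<le> n" for k
    using mono_of_steps[of n lam 0 k] assms(6,7) that by (simp add: less_imp_le)
  have event: "lam k \<le> \<bar>Y \<omega>\<bar> \<longleftrightarrow> (lam k)\<^sup>2 \<le> (Y \<omega>)\<^sup>2" if "k \<le> n" for k \<omega>
    using abs_le_square_iff[of "lam k" "Y \<omega>"] lam_nonneg[OF that] by simp
  have "(\<Sum>k=1..n. ((lam k)\<^sup>2 - (lam (k - 1))\<^sup>2) * measure M {\<omega> \<in> space M. lam k \<le> \<bar>Y \<omega>\<bar>})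
      = (\<Sum>k=1..n. ((lam k)\<^sup>2 - (lam (k - 1))\<^sup>2) * measure M {\<omega> \<in> space M. (lam k)\<^sup>2 \<le> (Y \<omega>)\<^sup>2})"
    by (intro sum.cong refl) (simp add: event)
  also have "ennreal \<dots> \<le> (\<integral>\<^sup>+ \<omega>. ennreal ((Y \<omega>)\<^sup>2) \<partial>M)"
  proof (rule layered_Markov)
    show "(\<lambda>\<omega>. (Y \<omega>)\<^sup>2) \<in> borel_measurable M"
      unfolding Y_def by measurable
    show "(lam k)\<^sup>2 \<le> (lam (Suc k))\<^sup>2" if "k < n" for k
      using assms(7)[OF that] lam_nonneg[of k] that by (intro power_mono) auto
  qed (use assms(6) in auto)
  finally show ?thesis
    unfolding Y_def ext_variance_def .
qed

end
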